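(* Let $\mathbf{Q}\in\mathbb{R}^{N\times N}$ be symmetric positive definite, $\mathbf{c}\in\mathbb{R}^N$, $\gamma>0$, with $c_n^2/(\mathbf{Q}^{-1})_{nn}\le\gamma$ for all $n=1,\ldots,N$. Assume that $\mathbf{Q}$ can be diagonalized as $\mathbf{Q}=(\mathbf{I}+\mathbf{\Delta})\mathbf{\Lambda}(\mathbf{I}+\mathbf{\Delta})^T$, where $\mathbf{I}+\mathbf{\Delta}=\mathbf{V}$ is the orthogonal matrix of eigenvectors of $\mathbf{Q}$, $\mathbf{\Lambda}=\mathrm{Diag}(\lambda_1(\mathbf{Q}),\ldots,\lambda_N(\mathbf{Q}))$ is the corresponding diagonal matrix of eigenvalues (in the order matching the columns of $\mathbf{V}$, not necessarily sorted), and $\mathbf{\Delta}$ is such that $\kappa(\mathbf{Q})\rho(\mathbf{\Delta})<1$. Let $K^*$ and $K_d$ be the maximum numbers of zero-valued components in the cardinality minimization problem with data $(\mathbf{Q},\mathbf{c},\gamma)$ and in its diagonal relaxation, respectively (see context). Define $$\underline{K}_{\mathrm{na}}=\max\{K:(1+\kappa(\mathbf{Q})(\rho(\mathbf{\Delta})+\rho(\mathbf{\Delta})^2))\,S_K(\{\lambda_n(\mathbf{Q})c_n^2\})\le\gamma\},$$ $$\overline{K}_{\mathrm{na}}=\max\{K:(1-\kappa(\mathbf{Q})\rho(\mathbf{\Delta}))\,S_K(\{\lambda_n(\mathbf{Q})c_n^2\})\le\gamma\}.$$ Then $\underline{K}_{\mathrm{na}}\le K^*\le K_d\le\overline{K}_{\mathrm{na}}$.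 The approximation ratio $K_d/K^*$ is bounded as follows: $$\frac{K_d}{K^*}\le\frac{\overline{K}_{\mathrm{na}}}{\underline{K}_{\mathrm{na}}}\le\frac{\lceil(\underline{K}_{\mathrm{na}}+1)\,r_{\mathrm{na}}\rceil-1}{\underline{K}_{\mathrm{na}}},\qquad r_{\mathrm{na}}=\frac{1+\kappa(\mathbf{Q})(\rho(\mathbf{\Delta})+\rho(\mathbf{\Delta})^2)}{1-\kappa(\mathbf{Q})\rho(\mathbf{\Delta})}.$$
   Context: The cardinality minimization problem with data $(\mathbf{Q},\mathbf{c},\gamma)$ is: minimize $C(\mathbf{x})$, the number of nonzero components of $\mathbf{x}\in\mathbb{R}^N$, subject to $(\mathbf{x}-\mathbf{c})^T\mathbf{Q}(\mathbf{x}-\mathbf{c})\le\gamma$. $K^*$ is $N$ minus its optimal cost, i.e. the maximum number of zero components of a feasible $\mathbf{x}$. The assumption on $c_n^2/(\mathbf{Q}^{-1})_{nn}$ says that for each $n$ there is a feasible $\mathbf{x}$ with $x_n=0$. $S_K(\{a_n\})$ denotes the sum of the $K$ smallest elements of the sequence $a_1,\ldots,a_N$; $K$ always denotes a number of components, at most $N$. Diagonal relaxation: for a diagonal matrix $\mathbf{D}$ with $\mathbf{0}\preceq\mathbf{D}\preceq\mathbf{Q}$ (Loewner order), replacing $\mathbf{Q}$ by $\mathbf{D}$ in the constraint gives a relaxation of the problem, which admits a feasible point with $K$ zero components iff $S_K(\{D_{nn}c_n^2\})\le\gamma$. The diagonal relaxation is the tightest relaxation of this kind. With $$E_d(K)=\max\{S_K(\{D_{nn}c_n^2\}):\mathbf{D}\text{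 diagonal},\ \mathbf{0}\preceq\mathbf{D}\preceq\mathbf{Q}\},$$ $K_d$ is the largest $K$ such that $E_d(K)\le\gamma$. $\rho(\cdot)$ is the spectral radius and $\kappa(\mathbf{Q})=\lambda_{\max}(\mathbf{Q})/\lambda_{\min}(\mathbf{Q})$ is the condition number (ratio of largest to smallest eigenvalue). *)

theory Defs
  imports "HOL-Analysis.Analysis"
begin

definition mat_spectrum :: "'a::field ^ 'n ^ 'n \<Rightarrow> 'a set" where
  "mat_spectrum A = {k. \<exists>v. v \<noteq> 0 \<and> A *v v = k *s v}"

text \<open>The spectral radius of a real matrix ranges over its complex eigenvalues; in general a real
  matrix need not have any real ones.\<close>

definition spectral_radius :: "real ^ 'n ^ 'n \<Rightarrow> real" where
  "spectral_radius A = Max (norm ` mat_spectrum (map_matrix complex_of_real A))"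

text \<open>Only meant for symmetric positive definite matrices, all of whose eigenvalues are real.\<close>

definition cond_number :: "real ^ 'n ^ 'n \<Rightarrow> real" where
  "cond_number Q = Max (mat_spectrum Q) / Min (mat_spectrum Q)"

definition pos_def :: "real ^ 'n ^ 'n \<Rightarrow> bool" where
  "pos_def A \<longleftrightarrow> transpose A = A \<and> (\<forall>x. x \<noteq> 0 \<longrightarrow> 0 < x \<bullet> (A *v x))"

definition pos_semidef :: "real ^ 'n ^ 'n \<Rightarrow> bool" where
  "pos_semidef A \<longleftrightarrow> transpose A = A \<and> (\<forall>x. 0 \<le> x \<bullet> (A *v x))"

definition loewner_le :: "real ^ 'n ^ 'n \<Rightarrow> real ^ 'n ^ 'n \<Rightarrow> bool" where
  "loewner_le A B \<longleftrightarrow> pos_semidef (B - A)"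

definition Diag :: "real ^ 'n \<Rightarrow> real ^ 'n ^ 'n" where
  "Diag d = (\<chi> i j. if i = j then d $ i else 0)"

definition is_diagonal :: "real ^ 'n ^ 'n \<Rightarrow> bool" where
  "is_diagonal D \<longleftrightarrow> (\<forall>i j. i \<noteq> j \<longrightarrow> D $ i $ j = 0)"

definition sum_smallest :: "nat \<Rightarrow> ('n::finite \<Rightarrow> real) \<Rightarrow> real" where
  "sum_smallest K a =
     sum_list (take K (sorted_list_of_multiset (image_mset a (mset_set UNIV))))"

definition cardinality :: "real ^ 'n \<Rightarrow> nat" where
  "cardinality x = card {n. x $ n \<noteq> 0}"

definition feasible_set :: "real ^ 'n ^ 'n \<Rightarrow> real ^ 'n \<Rightarrow> real \<Rightarrow> (real ^ 'n) set" where
  "feasible_set Q c \<gamma> = {x. (x - c) \<bullet> (Q *v (x - c)) \<le> \<gamma>}"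

definition optimal_cost :: "real ^ 'n ^ 'n \<Rightarrow> real ^ 'n \<Rightarrow> real \<Rightarrow> nat" where
  "optimal_cost Q c \<gamma> = Min (cardinality ` feasible_set Q c \<gamma>)"

definition K_star :: "real ^ 'n ^ 'n \<Rightarrow> real ^ 'n \<Rightarrow> real \<Rightarrow> nat" where
  "K_star Q c \<gamma> = CARD('n) - optimal_cost Q c \<gamma>"

text \<open>The maximum exists: the feasible matrices \<open>D\<close> form a nonempty compact set on which
  \<open>sum_smallest\<close> depends continuously on \<open>D\<close>.\<close>

definition E_d :: "real ^ 'n ^ 'n \<Rightarrow> real ^ 'n \<Rightarrow> nat \<Rightarrow> real" where
  "E_d Q c K = (GREATEST e. \<exists>D. is_diagonal D \<and> loewner_le 0 D \<and> loewner_le D Q \<and>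
                               e = sum_smallest K (\<lambda>n. D $ n $ n * (c $ n)\<^sup>2))"

definition K_d :: "real ^ 'n ^ 'n \<Rightarrow> real ^ 'n \<Rightarrow> real \<Rightarrow> nat" where
  "K_d Q c \<gamma> = Max {K. K \<le> CARD('n) \<and> E_d Q c K \<le> \<gamma>}"

text \<open>In the following, \<open>lam\<close> lists the eigenvalues of \<open>Q\<close> in the order of the columns of
  \<open>mat 1 + \<Delta>\<close>.\<close>

definition K_na_lower ::
  "real ^ 'n ^ 'n \<Rightarrow> real ^ 'n ^ 'n \<Rightarrow> real ^ 'n \<Rightarrow> real ^ 'n \<Rightarrow> real \<Rightarrow> nat" where
  "K_na_lower Q \<Delta> lam c \<gamma> = Max {K. K \<le> CARD('n) \<and>
     (1 + cond_number Q * (spectral_radius \<Delta> + (spectral_radius \<Delta>)\<^sup>2))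
       * sum_smallest K (\<lambda>n. lam $ n * (c $ n)\<^sup>2) \<le> \<gamma>}"

definition K_na_upper ::
  "real ^ 'n ^ 'n \<Rightarrow> real ^ 'n ^ 'n \<Rightarrow> real ^ 'n \<Rightarrow> real ^ 'n \<Rightarrow> real \<Rightarrow> nat" where
  "K_na_upper Q \<Delta> lam c \<gamma> = Max {K. K \<le> CARD('n) \<and>
     (1 - cond_number Q * spectral_radius \<Delta>)
       * sum_smallest K (\<lambda>n. lam $ n * (c $ n)\<^sup>2) \<le> \<gamma>}"

definition r_na :: "real ^ 'n ^ 'n \<Rightarrow> real ^ 'n ^ 'n \<Rightarrow> real" where
  "r_na Q \<Delta> = (1 + cond_number Q * (spectral_radius \<Delta> + (spectral_radius \<Delta>)\<^sup>2))
              / (1 - cond_number Q * spectral_radius \<Delta>)"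

text \<open>Ratio with values in the extended reals. \<open>K_na_lower\<close> can be 0, and a ratio with positive
  numerator and denominator 0 is \<open>\<infinity>\<close>, whereas real division would give 0.\<close>

definition ratio :: "real \<Rightarrow> real \<Rightarrow> ereal" where
  "ratio a b = ereal a / ereal b"

end

theory Submission
  imports Defs
begin

text \<open>
  Write \<open>V = mat 1 + \<Delta>\<close>, \<open>\<kappa>\<close> for the condition number, \<open>\<rho>\<close> for the spectral radius of \<open>\<Delta>\<close>, and
  \<open>q(y)\<close> for the sum of the \<open>lam $ n * (y $ n)\<^sup>2\<close>. The whole theorem rests on one two-sided estimate,
  \<open>\<bar>y \<bullet> (Q *v y) - q(y)\<bar> \<le> \<kappa> * \<rho> * q(y)\<close> (lemma \<open>eigenvalue_perturbation\<close>): if \<open>V\<close> is close to the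
  identity, then \<open>Q\<close> is close to the diagonal matrix of its own eigenvalues.

  To prove it, put \<open>w = transpose V *v y\<close>, so that \<open>y \<bullet> (Q *v y) = q(w)\<close> and \<open>norm w = norm y\<close>. Because
  the norms agree, the midpoint \<open>m\<close> of the extreme eigenvalues can be subtracted from every eigenvalue
  without changing \<open>q(w) - q(y)\<close>, which becomes the sum of the
  \<open>(lam $ n - m) * (w - y) $ n * (w + y) $ n\<close>. The first factor is at most half the spread of the
  spectrum, \<open>norm (w + y) \<le> 2 * norm y\<close>, and \<open>w - y = transpose \<Delta> *v y\<close>; Cauchy-Schwarz gives the bound
  once \<open>norm (transpose \<Delta> *v y) \<le> \<rho> * norm y\<close> is known. The last inequality holds since \<open>\<Delta>\<close> is normal,
  being an orthogonal matrix minus the identity (lemma \<open>norm_transpose_mult_le_spectral_radius\<close>).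

  Given the estimate, let \<open>S(K)\<close> be the sum of the \<open>K\<close> smallest \<open>lam $ n * (c $ n)\<^sup>2\<close>.
  \<^item> Setting to zero the components of \<open>c\<close> that realize \<open>S(K)\<close> costs at most \<open>(1 + \<kappa> * \<rho>) * S(K)\<close>. If
    that is at most \<open>\<gamma>\<close>, the point is feasible and has \<open>K\<close> zeros. This gives the lower bound on
    \<open>K_star\<close>, because \<open>1 + \<kappa> * \<rho> \<le> 1 + \<kappa> * (\<rho> + \<rho>\<^sup>2)\<close>.
  \<^item> A feasible point with \<open>K\<close> zeros satisfies the constraint of every diagonal relaxation, so
    \<open>K_star \<le> K_d\<close>.
  \<^item> The diagonal matrix with entries \<open>(1 - \<kappa> * \<rho>) * lam $ n\<close> lies below \<open>Q\<close> in the Loewner order, so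
    \<open>E_d\<close> is at least \<open>(1 - \<kappa> * \<rho>) * S(K)\<close>. This gives the upper bound on \<open>K_d\<close>.
  \<^item> The average \<open>S(K) / K\<close> of the smallest entries is nondecreasing in \<open>K\<close>. Hence two thresholds for
    \<open>S(K)\<close> that differ by a factor \<open>r\<close> are reached at counts that differ by about the same factor at
    most, which is the bound on the approximation ratio (lemma \<open>Max_upto_ratio\<close>).
\<close>

section \<open>Sums of the smallest entries\<close>

text \<open>The average over a set of small entries is at most the average over a set of large ones, in a form
  that stays meaningful when one of the sets is empty.\<close>

lemma card_scaled_sum_le:
  fixes a :: "'a \<Rightarrow> real"
  assumes "finite A" and "finite B" and "\<And>x y. x \<in> A \<Longrightarrow> y \<in> B \<Longrightarrow> a x \<le> a y"
  shows "real (card B) * sum a A \<le> real (card A) * sum a B"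
proof -
  have "real (card B) * sum a A = (\<Sum>x\<in>A. \<Sum>y\<in>B. a x)"
    by (simp add: sum_distrib_left)
  also have "\<dots> \<le> (\<Sum>x\<in>A. \<Sum>y\<in>B. a y)"
    using assms(3) by (intro sum_mono) auto
  also have "\<dots> = real (card A) * sum a B"
    by simp
  finally show ?thesis .
qed

text \<open>Sorting the indices by their values realizes all the sums of smallest entries at once, by an
  increasing chain of initial segments. This replaces the sorted list of values by sets of indices,
  in terms of which all later arguments are phrased.\<close>

lemma sum_smallest_chain:
  fixes a :: "'n::finite \<Rightarrow> real"
  obtains Z where "\<And>K. K \<le> CARD('n) \<Longrightarrow> card (Z K) = K"
    and "\<And>K. sum_smallest K a = sum a (Z K)"
    and "\<And>K M. K \<le> M \<Longrightarrow> Z K \<subseteq> Z M"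
    and "\<And>K x y. x \<in> Z K \<Longrightarrow> y \<notin> Z K \<Longrightarrow> a x \<le> a y"
proof -
  obtain us :: "'n list" where us: "set us = UNIV" "distinct us"
    using finite_distinct_list[of "UNIV :: 'n set"] by auto
  define zs where "zs = sort_key a us"
  have zs: "set zs = UNIV" "distinct zs" "sorted (map a zs)" "mset zs = mset us"
    using us by (auto simp: zs_def)
  have len: "length zs = CARD('n)"
    using zs(1,2) distinct_card by fastforce
  have "mset zs = mset_set UNIV"
    using mset_set_set[OF zs(2)] zs(1) by simp
  then have "image_mset a (mset_set UNIV) = mset (map a zs)"
    by simp
  then have "sorted_list_of_multiset (image_mset a (mset_set UNIV)) = map a zs"
    using zs(3) by (simp add: sorted_sort_id del: mset_map)
  then have S: "sum_smallest K a = sum a (set (take K zs))" for K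
    using zs(2) by (simp add: sum_smallest_def take_map sum_list_distinct_conv_sum_set)
  have le: "a x \<le> a y" if "x \<in> set (take K zs)" "y \<notin> set (take K zs)" for K x y
  proof -
    have "y \<in> set (drop K zs)"
      using that(2) zs(1) by (metis UNIV_I Un_iff append_take_drop_id set_append)
    moreover have "sorted (map a (take K zs) @ map a (drop K zs))"
      using zs(3) by (metis append_take_drop_id map_append)
    ultimately show ?thesis
      using that(1) by (auto simp: sorted_append)
  qed
  show ?thesis
    using le S zs(2) len
    by (intro that[of "\<lambda>K. set (take K zs)"])
       (auto simp: distinct_card set_take_subset_set_take subset_iff intro: set_take_subset_set_take[THEN subsetD])
qed

lemma sum_smallest_attained:
  fixes a :: "'n::finite \<Rightarrow> real"
  assumes "K \<le> CARD('n)"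
  obtains Z where "card Z = K" and "sum_smallest K a = sum a Z"
  using assms sum_smallest_chain[of a] by metis

text \<open>Compare with an initial segment \<open>A\<close> of the same size: what \<open>A\<close> has outside \<open>Z\<close> is as numerous
  as what \<open>Z\<close> has outside \<open>A\<close>, and entry by entry no larger.\<close>

lemma sum_smallest_le_sum:
  fixes a :: "'n::finite \<Rightarrow> real"
  shows "sum_smallest (card Z) a \<le> sum a Z"
proof -
  have N: "card Z \<le> CARD('n)"
    by (simp add: card_mono)
  obtain A where A: "card A = card Z" "sum_smallest (card Z) a = sum a A"
      "\<And>x y. x \<in> A \<Longrightarrow> y \<notin> A \<Longrightarrow> a x \<le> a y"
    using N sum_smallest_chain[of a] by metis
  have c: "card (A - Z) = card (Z - A)"
    using A(1) by (metis Int_commute card_Diff_subset_Int finite)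
  have "sum a (A - Z) \<le> sum a (Z - A)"
  proof (cases "card (A - Z) = 0")
    case True
    have "A - Z = {}"
      using True by (simp only: card_0_eq finite)
    moreover have "Z - A = {}"
      using True c by (metis card_0_eq finite)
    ultimately show ?thesis
      by (simp only: sum.empty order_refl)
  next
    case False
    have "real (card (Z - A)) * sum a (A - Z) \<le> real (card (A - Z)) * sum a (Z - A)"
      by (rule card_scaled_sum_le) (auto intro: A(3))
    then show ?thesis using False c by simp
  qed
  then have "sum a (A \<inter> Z) + sum a (A - Z) \<le> sum a (Z \<inter> A) + sum a (Z - A)"
    by (simp add: Int_commute)
  then show ?thesis
    using A(2) by (simp flip: sum.Int_Diff)
qed

lemma sum_smallest_0 [simp]: "sum_smallest 0 a = 0"
  by (simp add: sum_smallest_def)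

lemma sum_smallest_scale:
  fixes a :: "'n::finite \<Rightarrow> real"
  assumes "0 \<le> r" and "K \<le> CARD('n)"
  shows "sum_smallest K (\<lambda>n. r * a n) = r * sum_smallest K a"
proof (rule antisym)
  obtain Z where Z: "card Z = K" "sum_smallest K a = sum a Z"
    using sum_smallest_attained[OF assms(2)] .
  show "sum_smallest K (\<lambda>n. r * a n) \<le> r * sum_smallest K a"
    using sum_smallest_le_sum[of Z "\<lambda>n. r * a n"] Z by (simp add: sum_distrib_left)
  obtain Y where Y: "card Y = K" "sum_smallest K (\<lambda>n. r * a n) = (\<Sum>n\<in>Y. r * a n)"
    using sum_smallest_attained[OF assms(2)] .
  show "r * sum_smallest K a \<le> sum_smallest K (\<lambda>n. r * a n)"
    using mult_left_mono[OF sum_smallest_le_sum[of Y a] assms(1)] Y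
    by (simp add: sum_distrib_left)
qed

text \<open>The entries by which the sum grows from \<open>K\<close> to \<open>M\<close> terms are at least the ones already present,
  so the average cannot decrease; denominators are cleared.\<close>

lemma sum_smallest_average_mono:
  fixes a :: "'n::finite \<Rightarrow> real"
  assumes "K \<le> M" and "M \<le> CARD('n)"
  shows "real M * sum_smallest K a \<le> real K * sum_smallest M a"
proof -
  obtain Z where Z: "\<And>K. K \<le> CARD('n) \<Longrightarrow> card (Z K) = K"
      "\<And>K. sum_smallest K a = sum a (Z K)" "\<And>K M. K \<le> M \<Longrightarrow> Z K \<subseteq> Z M"
      "\<And>K x y. x \<in> Z K \<Longrightarrow> y \<notin> Z K \<Longrightarrow> a x \<le> a y"
    using sum_smallest_chain[of a] by blast
  define A B where "A = Z K" and "B = Z M"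
  have A: "card A = K" "sum_smallest K a = sum a A"
    and B: "card B = M" "sum_smallest M a = sum a B" and "A \<subseteq> B"
    and le: "\<And>x y. x \<in> A \<Longrightarrow> y \<notin> A \<Longrightarrow> a x \<le> a y"
    using assms Z by (auto simp: A_def B_def)
  have "real (card (B - A)) * sum a A \<le> real (card A) * sum a (B - A)"
    by (rule card_scaled_sum_le) (auto intro: le)
  moreover have "card (B - A) = M - K" and "sum a (B - A) = sum a B - sum a A"
    using \<open>A \<subseteq> B\<close> A(1) B(1) by (simp_all add: card_Diff_subset sum_diff finite)
  ultimately have "(real M - real K) * sum a A \<le> real K * (sum a B - sum a A)"
    using assms(1) A(1) by (simp add: of_nat_diff)
  then show ?thesis
    using A B by (simp add: algebra_simps)
qed

text \<open>As a minimum of finitely many linear functions, the sum of the \<open>K\<close> smallest entries depends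
  continuously on the entries; this is needed for the maximum in \<open>E_d\<close> to exist.\<close>

lemma sum_smallest_eq_Min:
  fixes a :: "'n::finite \<Rightarrow> real"
  assumes "K \<le> CARD('n)"
  shows "sum_smallest K a = Min (sum a ` {Z. card Z = K})"
proof (rule Min_eqI[symmetric])
  obtain Z where "card Z = K" and "sum_smallest K a = sum a Z"
    using sum_smallest_attained[OF assms] .
  then show "sum_smallest K a \<in> sum a ` {Z. card Z = K}"
    by auto
qed (auto intro: sum_smallest_le_sum)

lemma continuous_on_Min_image:
  fixes f :: "'i \<Rightarrow> 'a::topological_space \<Rightarrow> real"
  assumes "finite I" and "I \<noteq> {}" and "\<And>i. i \<in> I \<Longrightarrow> continuous_on S (f i)"
  shows "continuous_on S (\<lambda>x. Min ((\<lambda>i. f i x) ` I))"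
  using assms
proof (induction I rule: finite_ne_induct)
  case (insert i I)
  then have "continuous_on S (\<lambda>x. min (f i x) (Min ((\<lambda>i. f i x) ` I)))"
    by (intro continuous_on_min) auto
  then show ?case
    using insert by simp
qed simp

lemma continuous_on_sum_smallest:
  fixes f :: "'a::topological_space \<Rightarrow> 'n::finite \<Rightarrow> real"
  assumes "K \<le> CARD('n)" and "\<And>n. continuous_on S (\<lambda>x. f x n)"
  shows "continuous_on S (\<lambda>x. sum_smallest K (f x))"
proof -
  obtain Z :: "'n set" where "card Z = K"
    using sum_smallest_attained[OF assms(1)] .
  then show ?thesis
    unfolding sum_smallest_eq_Min[OF assms(1)]
    by (intro continuous_on_Min_image continuous_on_sum assms(2)) auto
qed

section \<open>Spectral radius\<close>

text \<open>Eigenvectors for distinct eigenvalues are independent: applying \<open>A\<close> to a relation and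
  subtracting \<open>l\<close> times the relation eliminates the eigenvector for \<open>l\<close> and multiplies the other
  coefficients by the nonzero numbers \<open>k - l\<close>.\<close>

lemma eigenvectors_independent:
  fixes A :: "'a::field ^ 'n ^ 'n"
  assumes "finite S" and "\<And>k. k \<in> S \<Longrightarrow> f k \<noteq> 0 \<and> A *v f k = k *s f k"
  shows "(\<Sum>k\<in>S. c k *s f k) = 0 \<Longrightarrow> k \<in> S \<Longrightarrow> c k = 0"
  using assms
proof (induction S arbitrary: c k rule: finite_induct)
  case (insert l S)
  let ?s = "\<Sum>k\<in>S. c k *s f k"
  have s: "c l *s f l + ?s = 0"
    using insert by simp
  have "A *v (c l *s f l + ?s) = (c l * l) *s f l + (\<Sum>k\<in>S. (c k * k) *s f k)"
    using insert.prems(3)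
    by (simp add: matrix_vector_right_distrib vec.linear_sum[OF matrix_vector_mul_linear_gen]
        vec.linear_scale[OF matrix_vector_mul_linear_gen])
  then have "(c l * l) *s f l + (\<Sum>k\<in>S. (c k * k) *s f k) = 0"
    using s by simp
  moreover have "(c l * l) *s f l + l *s ?s = 0"
    using arg_cong[OF s, of "\<lambda>v. l *s v"] by (simp add: vec.scale_right_distrib mult.commute)
  ultimately have "(\<Sum>k\<in>S. (c k * k) *s f k) - l *s ?s = 0"
    by (simp only: add_eq_0_iff) simp
  then have "(\<Sum>k\<in>S. (c k * (k - l)) *s f k) = 0"
    by (simp add: vec.scale_sum_right sum_subtractf vec.scale_left_diff_distrib
        right_diff_distrib mult.commute)
  then have S: "c k = 0" if "k \<in> S" for k
    using insert.IH[of "\<lambda>k. c k * (k - l)" k] insert.prems(3) insert.hyps(2) that by auto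
  then have "c l *s f l = 0"
    using s by simp
  then have "c l = 0"
    using insert.prems(3) by simp
  then show ?case
    using S insert.prems(2) by auto
qed simp

text \<open>Finiteness makes the maximum in the definition of the spectral radius a genuine upper bound.\<close>

lemma finite_mat_spectrum:
  fixes A :: "'a::field ^ 'n ^ 'n"
  shows "finite (mat_spectrum A)"
proof (rule ccontr)
  assume inf: "infinite (mat_spectrum A)"
  obtain S where S: "S \<subseteq> mat_spectrum A" "finite S" "card S = Suc CARD('n)"
    using infinite_arbitrarily_large[OF inf] by blast
  then have "\<forall>k\<in>S. \<exists>v. v \<noteq> 0 \<and> A *v v = k *s v"
    by (auto simp: mat_spectrum_def)
  then obtain f where f: "\<And>k. k \<in> S \<Longrightarrow> f k \<noteq> 0 \<and> A *v f k = k *s f k"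
    by metis
  have inj: "inj_on f S"
    by (rule inj_onI) (metis f vec.scale_right_imp_eq)
  have "vec.independent (f ` S)"
    using eigenvectors_independent[OF S(2) f, where c = "\<lambda>k. u (f k)" for u]
    by (simp add: vec.dependent_finite[OF finite_imageI[OF S(2)]] sum.reindex[OF inj]) blast
  then have "card (f ` S) \<le> vec.dim (UNIV :: ('a^'n) set)"
    by (intro vec.independent_card_le_dim) auto
  then show False
    unfolding vec_dim_card using inj S(3) by (simp add: card_image)
qed

lemma norm_eigenvalue_le_spectral_radius:
  assumes "z \<in> mat_spectrum (map_matrix complex_of_real A)"
  shows "norm z \<le> spectral_radius A"
  unfolding spectral_radius_def using assms by (intro Max_ge) (auto simp: finite_mat_spectrum)

text \<open>A unit vector \<open>y\<close> that \<open>A\<close> stretches the most exists by compactness, and the first-order condition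
  for this maximum says that it is an eigenvector of \<open>transpose A ** A\<close>.\<close>

lemma max_stretch_attained:
  fixes A :: "real ^ 'n ^ 'm"
  obtains y where "norm y = 1" and "\<And>x. norm (A *v x) \<le> norm (A *v y) * norm x"
    and "transpose A *v (A *v y) = (norm (A *v y))\<^sup>2 *\<^sub>R y"
proof -
  have "sphere (0 :: real^'n) 1 \<noteq> {}"
    by simp
  then obtain y where y: "norm y = 1" "\<And>x. norm x = 1 \<Longrightarrow> norm (A *v x) \<le> norm (A *v y)"
    using continuous_attains_sup[of "sphere (0 :: real^'n) 1" "\<lambda>x. norm (A *v x)"]
    by (auto simp: matrix_vector_mult_linear_continuous_on continuous_on_norm)
  define m where "m = norm (A *v y)"
  have le: "norm (A *v x) \<le> m * norm x" for x
  proof (cases "x = 0")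
    case False
    then have "norm (A *v (x /\<^sub>R norm x)) \<le> m"
      unfolding m_def by (intro y(2)) simp
    then show ?thesis
      using False by (simp add: matrix_vector_mult_scaleR divide_simps mult.commute)
  qed simp
  define z where "z = m\<^sup>2 *\<^sub>R y - transpose A *v (A *v y)"
  have zx: "z \<bullet> x = m\<^sup>2 * (y \<bullet> x) - (A *v y) \<bullet> (A *v x)" for x
    by (simp add: z_def inner_diff_left dot_lmul_matrix)
  have "2 * t * (z \<bullet> x) + t\<^sup>2 * (m\<^sup>2 * (norm x)\<^sup>2 - (norm (A *v x))\<^sup>2) \<ge> 0" for t x
  proof -
    have "(norm (A *v (y + t *\<^sub>R x)))\<^sup>2 \<le> (m * norm (y + t *\<^sub>R x))\<^sup>2"
      by (intro power_mono le) simp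
    moreover have "(norm (A *v (y + t *\<^sub>R x)))\<^sup>2
        = m\<^sup>2 + 2 * t * ((A *v y) \<bullet> (A *v x)) + t\<^sup>2 * (norm (A *v x))\<^sup>2"
      unfolding m_def power2_norm_eq_inner matrix_vector_right_distrib matrix_vector_mult_scaleR
      by (simp add: inner_add inner_commute power2_eq_square ring_distribs mult_ac)
    moreover have "(norm (y + t *\<^sub>R x))\<^sup>2 = 1 + 2 * t * (y \<bullet> x) + t\<^sup>2 * (norm x)\<^sup>2"
      using y(1) unfolding power2_norm_eq_inner norm_eq_1
      by (simp add: inner_add inner_commute power2_eq_square ring_distribs mult_ac)
    ultimately show ?thesis
      by (simp add: zx power_mult_distrib algebra_simps)
  qed
  note quad = this
  \<comment> \<open>In direction \<open>z\<close> this is a nonnegative quadratic in \<open>t\<close> without constant term, so its linear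
    coefficient \<open>2 * (z \<bullet> z)\<close> vanishes. The step \<open>t\<close> below has denominator \<open>q + 1\<close> instead of \<open>q\<close>, the
    minimizing choice, because \<open>q\<close> may be zero.\<close>
  define q where "q = m\<^sup>2 * (norm z)\<^sup>2 - (norm (A *v z))\<^sup>2"
  have "z \<bullet> z = 0"
  proof (rule ccontr)
    assume "z \<bullet> z \<noteq> 0"
    then have zz: "z \<bullet> z > 0" by simp
    have q: "q \<ge> 0"
      using power_mono[OF le[of z], of 2] by (simp add: q_def power_mult_distrib)
    define t where "t = - (z \<bullet> z) / (q + 1)"
    have t: "t * (q + 1) = - (z \<bullet> z)"
      using q by (simp add: t_def)
    have tn: "t < 0"
      using zz q by (simp add: t_def)
    have "2 * t * (z \<bullet> z) + t\<^sup>2 * q \<ge> 0"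
      using quad[of t z] by (simp add: q_def)
    then have "t * (2 * (z \<bullet> z) + t * q) \<ge> 0"
      by (simp add: algebra_simps power2_eq_square power4_eq_xxxx)
    then have "2 * (z \<bullet> z) + t * q \<le> 0"
      using tn by (simp add: zero_le_mult_iff)
    then show False using t tn zz by (simp add: algebra_simps)
  qed
  then have "transpose A *v (A *v y) = m\<^sup>2 *\<^sub>R y"
    by (simp add: z_def)
  then show ?thesis
    using that[of y] y(1) le by (simp add: m_def)
qed

definition complexify :: "real ^ 'n \<Rightarrow> complex ^ 'n" where
  "complexify v = (\<chi> i. complex_of_real (v $ i))"

lemma complexify_simps:
  "complexify (u + v) = complexify u + complexify v"
  "complexify (r *\<^sub>R v) = complex_of_real r *s complexify v"
  "complexify v = 0 \<longleftrightarrow> v = 0"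
  "map_matrix complex_of_real A *v complexify v = complexify (A *v v)"
  by (auto simp: complexify_def vec_eq_iff map_matrix_def matrix_vector_mult_def)

text \<open>The hypothesis says that \<open>(B - z) (B - w)\<close> annihilates \<open>u\<close>. Either the inner factor already does,
  or it maps \<open>u\<close> to an eigenvector for \<open>z\<close>.\<close>

lemma quadratic_root_in_spectrum:
  fixes B :: "'a::field ^ 'n ^ 'n"
  assumes "u \<noteq> 0" and "B *v (B *v u) - (z + w) *s (B *v u) + (z * w) *s u = 0"
  shows "z \<in> mat_spectrum B \<or> w \<in> mat_spectrum B"
proof -
  define v where "v = B *v u - w *s u"
  have "B *v v = B *v (B *v u) - w *s (B *v u)"
    by (simp add: v_def matrix_vector_mult_diff_distrib vec.linear_scale[OF matrix_vector_mul_linear_gen])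
  also have "\<dots> = z *s v"
    using assms(2)
    by (simp add: v_def vec_eq_iff algebra_simps)
  finally have "B *v v = z *s v" .
  moreover have "B *v u = w *s u" if "v = 0"
    using that by (simp add: v_def)
  ultimately show ?thesis
    using assms(1) by (auto simp: mat_spectrum_def)
qed

lemma orthogonal_norm:
  fixes V :: "real ^ 'n ^ 'n"
  assumes "orthogonal_matrix V"
  shows "norm (transpose V *v y) = norm y"
  using assms orthogonal_transformation_matrix[of "(*v) (transpose V)"]
  by (simp add: orthogonal_transformation del: transpose_matrix_vector)

text \<open>For the normal matrix \<open>\<Delta>\<close> the operator norm is the spectral radius. Let \<open>m\<close> be the
  operator norm of \<open>transpose \<Delta>\<close> and \<open>y\<close> a vector attaining it, so \<open>\<Delta> ** transpose \<Delta>\<close> maps \<open>y\<close> to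
  \<open>m\<^sup>2 *\<^sub>R y\<close>. Orthogonality of \<open>mat 1 + \<Delta>\<close> means \<open>\<Delta> + transpose \<Delta> + \<Delta> ** transpose \<Delta> = 0\<close>, which
  eliminates the transpose: \<open>\<Delta>\<^sup>2 + m\<^sup>2 \<Delta> + m\<^sup>2\<close> annihilates \<open>y\<close>. Since \<open>m \<le> 2\<close>, the polynomial
  \<open>X\<^sup>2 + m\<^sup>2 X + m\<^sup>2\<close> has two conjugate complex roots, of modulus \<open>m\<close>, and one of them is an
  eigenvalue of \<open>\<Delta>\<close>.\<close>

lemma norm_transpose_mult_le_spectral_radius:
  fixes \<Delta> :: "real ^ 'n ^ 'n"
  assumes "orthogonal_matrix (mat 1 + \<Delta>)"
  shows "norm (transpose \<Delta> *v x) \<le> spectral_radius \<Delta> * norm x"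
proof -
  let ?T = "transpose \<Delta>"
  obtain y where y: "norm y = 1" and max: "\<And>x. norm (?T *v x) \<le> norm (?T *v y) * norm x"
    and eig: "transpose ?T *v (?T *v y) = (norm (?T *v y))\<^sup>2 *\<^sub>R y"
    using max_stretch_attained[of ?T] by metis
  define m where "m = norm (?T *v y)"
  have "transpose (mat 1 + \<Delta>) = mat 1 + ?T"
    by (simp add: transpose_def vec_eq_iff mat_def)
  then have T: "?T *v y = transpose (mat 1 + \<Delta>) *v y - y"
    by (simp add: matrix_vector_mult_add_rdistrib del: transpose_matrix_vector)
  have "m \<le> norm (transpose (mat 1 + \<Delta>) *v y) + norm y"
    unfolding m_def T by (rule norm_triangle_ineq4)
  then have m: "0 \<le> m" "m \<le> 2"
    using orthogonal_norm[OF assms, of y] y by (simp_all add: m_def)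
  have "(mat 1 + \<Delta>) *v (transpose (mat 1 + \<Delta>) *v y) = y"
    using assms by (simp add: orthogonal_matrix_def matrix_vector_mul_assoc del: transpose_matrix_vector)
  moreover have "transpose (mat 1 + \<Delta>) *v y = y + ?T *v y"
    using T by simp
  ultimately have "?T *v y + \<Delta> *v y + \<Delta> *v (?T *v y) = 0"
    by (simp add: matrix_vector_mult_add_rdistrib matrix_vector_right_distrib add_ac
        del: transpose_matrix_vector)
  then have "?T *v y = - (\<Delta> *v y) - m\<^sup>2 *\<^sub>R y"
    using eig by (simp add: m_def algebra_simps eq_neg_iff_add_eq_0 del: transpose_matrix_vector)
  then have "\<Delta> *v (- (\<Delta> *v y) - m\<^sup>2 *\<^sub>R y) = m\<^sup>2 *\<^sub>R y"
    using eig by (simp add: m_def del: transpose_matrix_vector)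
  then have "- (\<Delta> *v (\<Delta> *v y)) - m\<^sup>2 *\<^sub>R (\<Delta> *v y) = m\<^sup>2 *\<^sub>R y"
    by (simp add: matrix_vector_mult_diff_distrib matrix_vector_mult_scaleR
        vec.linear_neg[OF matrix_vector_mul_linear_gen])
  from this[symmetric]
  have rel: "\<Delta> *v (\<Delta> *v y) + m\<^sup>2 *\<^sub>R (\<Delta> *v y) + m\<^sup>2 *\<^sub>R y = 0"
    by simp
  \<comment> \<open>a root of \<open>X\<^sup>2 + m\<^sup>2 X + m\<^sup>2\<close>; the other root is its conjugate\<close>
  define z where "z = Complex (- m\<^sup>2 / 2) (m * sqrt (1 - m\<^sup>2 / 4))"
  have "m\<^sup>2 \<le> 4"
    using power_mono[OF m(2) m(1), of 2] by simp
  then have nz: "(cmod z)\<^sup>2 = m\<^sup>2"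
    unfolding z_def cmod_power2 complex.sel power_mult_distrib
    by (simp add: power_divide) (simp add: algebra_simps power2_eq_square power4_eq_xxxx)
  then have zm: "cmod z = m"
    using m(1) by simp
  have zw: "z + cnj z = - complex_of_real (m\<^sup>2)" "z * cnj z = complex_of_real (m\<^sup>2)"
    unfolding complex_norm_square[symmetric] nz
    by (simp_all add: complex_add_cnj z_def complex_eq_iff)
  have "complexify (\<Delta> *v (\<Delta> *v y) + m\<^sup>2 *\<^sub>R (\<Delta> *v y) + m\<^sup>2 *\<^sub>R y) = 0"
    using rel by (simp add: complexify_simps(3))
  then have "z \<in> mat_spectrum (map_matrix complex_of_real \<Delta>)
      \<or> cnj z \<in> mat_spectrum (map_matrix complex_of_real \<Delta>)"
    using y by (intro quadratic_root_in_spectrum[where u = "complexify y"], unfold zw)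
      (auto simp: complexify_simps vec.scale_minus_left simp del: of_real_power)
  then have "m \<le> spectral_radius \<Delta>"
    using norm_eigenvalue_le_spectral_radius[of _ \<Delta>] zm by fastforce
  then have "m * norm x \<le> spectral_radius \<Delta> * norm x"
    by (rule mult_right_mono) simp
  then show ?thesis
    using max[of x] unfolding m_def by linarith
qed

section \<open>Comparison of the matrix with its eigenvalues\<close>

lemma Diag_mult_vec: "Diag d *v x = (\<chi> n. d $ n * x $ n)"
  by (simp add: Diag_def matrix_vector_mult_def vec_eq_iff if_distrib[of "\<lambda>a. a * _"] cong: if_cong)

lemma inner_Diag: "x \<bullet> (Diag d *v x) = (\<Sum>n\<in>UNIV. d $ n * (x $ n)\<^sup>2)"
  by (simp add: Diag_mult_vec inner_vec_def power2_eq_square mult_ac)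

lemma inner_eigenbasis:
  fixes V :: "real ^ 'n ^ 'n"
  shows "y \<bullet> ((V ** Diag lam ** transpose V) *v y)
    = (\<Sum>n\<in>UNIV. lam $ n * ((transpose V *v y) $ n)\<^sup>2)"
proof -
  have "(V ** Diag lam ** transpose V) *v y = V *v (Diag lam *v (transpose V *v y))"
    by (simp only: matrix_vector_mul_assoc matrix_mul_assoc)
  then have "y \<bullet> ((V ** Diag lam ** transpose V) *v y)
      = (transpose V *v y) \<bullet> (Diag lam *v (transpose V *v y))"
    by (simp add: dot_lmul_matrix)
  then show ?thesis
    by (simp only: inner_Diag)
qed

lemma eigenvector_column:
  fixes V :: "real ^ 'n ^ 'n"
  assumes "orthogonal_matrix V"
  shows "transpose V *v (V *v axis i 1) = axis i 1"
  using assms by (simp add: matrix_vector_mul_assoc orthogonal_matrix_def del: transpose_matrix_vector)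

lemma mat_spectrum_diagonalized:
  fixes V :: "real ^ 'n ^ 'n"
  assumes "orthogonal_matrix V"
  shows "mat_spectrum (V ** Diag lam ** transpose V) = range (($) lam)"
proof (intro equalityI subsetI)
  fix k
  assume "k \<in> mat_spectrum (V ** Diag lam ** transpose V)"
  then obtain v where v: "v \<noteq> 0" "V *v (Diag lam *v (transpose V *v v)) = k *s v"
    unfolding mat_spectrum_def by (auto simp: matrix_vector_mul_assoc matrix_mul_assoc simp del: transpose_matrix_vector)
  define w where "w = transpose V *v v"
  have "Diag lam *v w = transpose V *v (V *v (Diag lam *v w))"
    using assms
    by (simp add: matrix_vector_mul_assoc matrix_mul_assoc orthogonal_matrix_def del: transpose_matrix_vector)
  also have "\<dots> = k *s w"
    using v(2) unfolding w_def by (simp only: vec.linear_scale[OF matrix_vector_mul_linear_gen])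
  finally have "lam $ n * w $ n = k * w $ n" for n
    by (auto simp: Diag_mult_vec vec_eq_iff)
  moreover have "norm w = norm v"
    unfolding w_def by (rule orthogonal_norm[OF assms])
  then obtain n where "w $ n \<noteq> 0"
    using v(1) by (metis norm_eq_zero vec_eq_iff zero_index)
  ultimately show "k \<in> range (($) lam)"
    by (metis mult_right_cancel rangeI)
next
  fix k
  assume "k \<in> range (($) lam)"
  then obtain n where k: "k = lam $ n"
    by auto
  have "(V ** Diag lam ** transpose V) *v (V *v axis n 1)
      = V *v (Diag lam *v (transpose V *v (V *v axis n 1)))"
    by (simp only: matrix_vector_mul_assoc matrix_mul_assoc)
  also have "\<dots> = V *v (Diag lam *v axis n 1)"
    by (simp only: eigenvector_column[OF assms])
  also have "Diag lam *v axis n 1 = k *s axis n 1"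
    by (simp add: Diag_mult_vec k vec_eq_iff axis_def)
  also have "V *v (k *s axis n 1) = k *s (V *v axis n 1)"
    by (rule vec.linear_scale[OF matrix_vector_mul_linear_gen])
  finally have "(V ** Diag lam ** transpose V) *v (V *v axis n 1) = k *s (V *v axis n 1)" .
  moreover have "V *v axis n 1 \<noteq> 0"
    using eigenvector_column[OF assms, of n] by (auto simp: axis_eq_0_iff)
  ultimately show "k \<in> mat_spectrum (V ** Diag lam ** transpose V)"
    unfolding mat_spectrum_def by blast
qed

lemma eigenvalue_pos:
  fixes V :: "real ^ 'n ^ 'n"
  assumes "orthogonal_matrix V" and "pos_def (V ** Diag lam ** transpose V)"
  shows "0 < lam $ n"
proof -
  let ?v = "V *v axis n 1"
  have "?v \<noteq> 0"
    using eigenvector_column[OF assms(1), of n] by (auto simp: axis_eq_0_iff)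
  then have "0 < ?v \<bullet> ((V ** Diag lam ** transpose V) *v ?v)"
    using assms(2) by (simp add: pos_def_def)
  also have "\<dots> = lam $ n"
    unfolding inner_eigenbasis eigenvector_column[OF assms(1)]
    by (simp add: axis_def if_distrib[of "\<lambda>a. a\<^sup>2"] if_distrib[of "\<lambda>a. _ * a"] cong: if_cong)
  finally show ?thesis .
qed

text \<open>Equality of the norms allows every weight to be shifted by the midpoint \<open>m\<close>. The weights are then
  at most half of \<open>u - l\<close> in modulus, and this half absorbs the factor 2 in
  \<open>norm (w + y) \<le> 2 * norm y\<close>.\<close>

lemma abs_weighted_squares_diff_le:
  fixes lam w y :: "real ^ 'n"
  assumes "norm w = norm y" and "\<And>n. l \<le> lam $ n" and "\<And>n. lam $ n \<le> u"
  shows "\<bar>(\<Sum>n\<in>UNIV. lam $ n * (w $ n)\<^sup>2) - (\<Sum>n\<in>UNIV. lam $ n * (y $ n)\<^sup>2)\<bar>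
    \<le> (u - l) * (norm (w - y) * norm y)"
proof -
  define m h where "m = (u + l) / 2" and "h = (u - l) / 2"
  have h: "\<bar>lam $ n - m\<bar> \<le> h" for n
    using assms(2,3)[of n] by (simp add: m_def h_def abs_le_iff field_simps)
  have sq: "(\<Sum>n\<in>UNIV. (w $ n)\<^sup>2) = (\<Sum>n\<in>UNIV. (y $ n)\<^sup>2)"
    using assms(1) by (simp add: norm_eq inner_vec_def power2_eq_square)
  have "(\<Sum>n\<in>UNIV. lam $ n * (w $ n)\<^sup>2) - (\<Sum>n\<in>UNIV. lam $ n * (y $ n)\<^sup>2)
      = (\<Sum>n\<in>UNIV. lam $ n * ((w $ n)\<^sup>2 - (y $ n)\<^sup>2)) - m * (\<Sum>n\<in>UNIV. (w $ n)\<^sup>2 - (y $ n)\<^sup>2)"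
    using sq by (simp add: sum_subtractf right_diff_distrib)
  also have "\<dots> = (\<Sum>n\<in>UNIV. (lam $ n - m) * ((w - y) $ n * (w + y) $ n))"
    by (simp add: sum_distrib_left sum_subtractf[symmetric] power2_eq_square algebra_simps)
  finally have "\<bar>(\<Sum>n\<in>UNIV. lam $ n * (w $ n)\<^sup>2) - (\<Sum>n\<in>UNIV. lam $ n * (y $ n)\<^sup>2)\<bar>
      \<le> (\<Sum>n\<in>UNIV. \<bar>(lam $ n - m) * ((w - y) $ n * (w + y) $ n)\<bar>)"
    by (simp only: sum_abs)
  also have "\<dots> \<le> (\<Sum>n\<in>UNIV. h * (\<bar>(w - y) $ n\<bar> * \<bar>(w + y) $ n\<bar>))"
    unfolding abs_mult by (intro sum_mono mult_right_mono h) simp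
  also have "\<dots> \<le> h * (norm (w - y) * norm (w + y))"
    unfolding sum_distrib_left[symmetric] norm_vec_def real_norm_def
    using L2_set_mult_ineq[of "\<lambda>n. (w - y) $ n" "\<lambda>n. (w + y) $ n" UNIV] h[of undefined]
    by (intro mult_left_mono) (auto simp: L2_set_def)
  also have "\<dots> \<le> h * (norm (w - y) * (2 * norm y))"
    using norm_triangle_ineq[of w y] assms(1) h[of undefined] by (intro mult_left_mono) auto
  finally show ?thesis
    by (simp add: h_def mult_ac)
qed

text \<open>The previous bound is in terms of \<open>(norm y)\<^sup>2\<close>; replacing this by the weighted sum divided by
  the smallest eigenvalue turns the largest eigenvalue into the condition number.\<close>

lemma eigenvalue_perturbation:
  fixes Q \<Delta> :: "real ^ 'n ^ 'n"
  assumes pd: "pos_def Q" and orth: "orthogonal_matrix (mat 1 + \<Delta>)"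
    and Q: "Q = (mat 1 + \<Delta>) ** Diag lam ** transpose (mat 1 + \<Delta>)"
  shows "\<bar>y \<bullet> (Q *v y) - (\<Sum>n\<in>UNIV. lam $ n * (y $ n)\<^sup>2)\<bar>
      \<le> cond_number Q * spectral_radius \<Delta> * (\<Sum>n\<in>UNIV. lam $ n * (y $ n)\<^sup>2)"
    and "0 \<le> spectral_radius \<Delta>" and "0 \<le> cond_number Q" and "0 < lam $ n"
proof -
  let ?V = "mat 1 + \<Delta>" and ?\<rho> = "spectral_radius \<Delta>"
  define u l where "u = Max (range (($) lam))" and "l = Min (range (($) lam))"
  have cond: "cond_number Q = u / l"
    by (simp add: cond_number_def Q mat_spectrum_diagonalized[OF orth] u_def l_def)
  have lu: "l \<le> lam $ n" "lam $ n \<le> u" for n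
    by (simp_all add: l_def u_def)
  have pos: "0 < lam $ n" for n
    using eigenvalue_pos[OF orth] pd Q by simp
  then show "0 < lam $ n" .
  have l: "0 < l"
    using pos by (simp add: l_def)
  have u: "0 < u"
    using l lu[of undefined] by linarith
  show "0 \<le> cond_number Q"
    using l u by (simp add: cond)
  have "norm (transpose \<Delta> *v axis undefined 1) \<le> ?\<rho> * norm (axis undefined 1 :: real ^ 'n)"
    by (rule norm_transpose_mult_le_spectral_radius[OF orth])
  then show \<rho>: "0 \<le> ?\<rho>"
    using order_trans[OF norm_ge_zero] by (fastforce simp: norm_axis_1)
  define w where "w = transpose ?V *v y"
  have "transpose ?V = mat 1 + transpose \<Delta>"
    by (simp add: transpose_def vec_eq_iff mat_def)
  then have "w - y = transpose \<Delta> *v y"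
    by (simp add: w_def matrix_vector_mult_add_rdistrib del: transpose_matrix_vector)
  then have wy: "norm (w - y) \<le> ?\<rho> * norm y"
    using norm_transpose_mult_le_spectral_radius[OF orth] by simp
  have "norm w = norm y"
    unfolding w_def by (rule orthogonal_norm[OF orth])
  then have "\<bar>y \<bullet> (Q *v y) - (\<Sum>n\<in>UNIV. lam $ n * (y $ n)\<^sup>2)\<bar> \<le> (u - l) * (norm (w - y) * norm y)"
    unfolding Q inner_eigenbasis w_def[symmetric] by (rule abs_weighted_squares_diff_le) (rule lu)+
  also have "\<dots> \<le> u * (?\<rho> * norm y * norm y)"
    using l u wy \<rho> by (intro mult_mono mult_right_mono) auto
  also have "\<dots> = cond_number Q * ?\<rho> * (l * (norm y)\<^sup>2)"
    using l by (simp add: cond power2_eq_square)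
  also have "\<dots> \<le> cond_number Q * ?\<rho> * (\<Sum>n\<in>UNIV. lam $ n * (y $ n)\<^sup>2)"
  proof (intro mult_left_mono)
    have "(norm y)\<^sup>2 = (\<Sum>n\<in>UNIV. (y $ n)\<^sup>2)"
      unfolding power2_norm_eq_inner inner_vec_def by (simp add: power2_eq_square)
    then show "l * (norm y)\<^sup>2 \<le> (\<Sum>n\<in>UNIV. lam $ n * (y $ n)\<^sup>2)"
      by (simp add: sum_distrib_left sum_mono mult_right_mono lu)
  qed (use \<open>0 \<le> cond_number Q\<close> \<rho> in simp)
  finally show "\<bar>y \<bullet> (Q *v y) - (\<Sum>n\<in>UNIV. lam $ n * (y $ n)\<^sup>2)\<bar>
      \<le> cond_number Q * ?\<rho> * (\<Sum>n\<in>UNIV. lam $ n * (y $ n)\<^sup>2)" .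
qed

section \<open>The diagonal relaxation\<close>

text \<open>The diagonals of the matrices over which \<open>E_d\<close> maximizes, described by closed conditions on
  vectors, so that compactness can be proved in Euclidean space.\<close>

definition diagonal_minorants :: "real ^ 'n ^ 'n \<Rightarrow> (real ^ 'n) set" where
  "diagonal_minorants Q = {d. \<forall>x. 0 \<le> (\<Sum>n\<in>UNIV. d $ n * (x $ n)\<^sup>2)
     \<and> (\<Sum>n\<in>UNIV. d $ n * (x $ n)\<^sup>2) \<le> x \<bullet> (Q *v x)}"

lemma diagonal_minorants_iff:
  fixes Q :: "real ^ 'n ^ 'n"
  assumes "transpose Q = Q"
  shows "is_diagonal D \<and> loewner_le 0 D \<and> loewner_le D Q
    \<longleftrightarrow> (\<exists>d\<in>diagonal_minorants Q. D = Diag d)"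
proof -
  have sym: "transpose (Diag d) = Diag d" for d :: "real ^ 'n"
    by (auto simp: transpose_def Diag_def vec_eq_iff)
  have diff: "transpose (Q - Diag d) = Q - Diag d" for d
    using assms sym[of d] by (simp add: transpose_def vec_eq_iff)
  have Diag: "loewner_le 0 (Diag d) \<and> loewner_le (Diag d) Q \<longleftrightarrow> d \<in> diagonal_minorants Q" for d
    unfolding loewner_le_def pos_semidef_def diagonal_minorants_def
    by (auto simp: sym diff inner_Diag matrix_vector_mult_diff_rdistrib inner_diff_right)
  show ?thesis
  proof
    assume D: "is_diagonal D \<and> loewner_le 0 D \<and> loewner_le D Q"
    then have "D = Diag (\<chi> n. D $ n $ n)"
      by (auto simp: is_diagonal_def Diag_def vec_eq_iff)
    then show "\<exists>d\<in>diagonal_minorants Q. D = Diag d"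
      using D Diag[of "\<chi> n. D $ n $ n"] by auto
  next
    assume "\<exists>d\<in>diagonal_minorants Q. D = Diag d"
    then show "is_diagonal D \<and> loewner_le 0 D \<and> loewner_le D Q"
      using Diag by (auto simp: is_diagonal_def) (simp add: Diag_def)
  qed
qed

text \<open>Boundedness comes from testing with the coordinate vectors: each \<open>d $ n\<close> lies between 0 and the
  corresponding diagonal entry of \<open>Q\<close>.\<close>

lemma compact_diagonal_minorants: "compact (diagonal_minorants Q)"
proof -
  have "closed (diagonal_minorants Q)"
    unfolding diagonal_minorants_def
    by (intro closed_Collect_all closed_Collect_conj closed_Collect_le continuous_intros)
  moreover have "diagonal_minorants Q \<subseteq> cbox 0 (\<chi> n. axis n 1 \<bullet> (Q *v axis n 1))"
  proof
    fix d
    assume d: "d \<in> diagonal_minorants Q"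
    have "(\<Sum>i\<in>UNIV. d $ i * (axis n 1 $ i)\<^sup>2) = d $ n" for n
      by (simp add: axis_def if_distrib[of "\<lambda>a. a\<^sup>2"] if_distrib[of "\<lambda>a. _ * a"] cong: if_cong)
    then show "d \<in> cbox 0 (\<chi> n. axis n 1 \<bullet> (Q *v axis n 1))"
      using d unfolding diagonal_minorants_def mem_box_cart mem_Collect_eq
      by (metis vec_lambda_beta zero_index)
  qed
  ultimately show ?thesis
    using bounded_cbox bounded_subset compact_eq_bounded_closed by blast
qed

text \<open>Continuity on a compact set makes the \<open>GREATEST\<close> in \<open>E_d\<close> a genuine maximum.\<close>

lemma E_d_attained:
  fixes Q :: "real ^ 'n ^ 'n"
  assumes "pos_def Q" and "K \<le> CARD('n)"
  obtains d where "d \<in> diagonal_minorants Q"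
    and "E_d Q c K = sum_smallest K (\<lambda>n. d $ n * (c $ n)\<^sup>2)"
    and "\<And>d'. d' \<in> diagonal_minorants Q \<Longrightarrow> sum_smallest K (\<lambda>n. d' $ n * (c $ n)\<^sup>2) \<le> E_d Q c K"
proof -
  let ?S = "\<lambda>d. sum_smallest K (\<lambda>n. d $ n * (c $ n)\<^sup>2)"
  have sym: "transpose Q = Q"
    using assms(1) by (simp add: pos_def_def)
  have "0 \<le> x \<bullet> (Q *v x)" for x
    using assms(1) by (cases "x = 0") (auto simp: pos_def_def less_imp_le)
  then have "0 \<in> diagonal_minorants Q"
    by (simp add: diagonal_minorants_def)
  then have "\<exists>d\<in>diagonal_minorants Q. \<forall>d'\<in>diagonal_minorants Q. ?S d' \<le> ?S d"
    using assms(2)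
    by (intro continuous_attains_sup compact_diagonal_minorants continuous_on_sum_smallest
        continuous_intros) auto
  then obtain d where d: "d \<in> diagonal_minorants Q" "\<And>d'. d' \<in> diagonal_minorants Q \<Longrightarrow> ?S d' \<le> ?S d"
    by blast
  have ex: "(\<exists>D. is_diagonal D \<and> loewner_le 0 D \<and> loewner_le D Q \<and>
      e = sum_smallest K (\<lambda>n. D $ n $ n * (c $ n)\<^sup>2)) \<longleftrightarrow> (\<exists>d\<in>diagonal_minorants Q. e = ?S d)" for e
  proof -
    have "(\<exists>D. is_diagonal D \<and> loewner_le 0 D \<and> loewner_le D Q \<and>
        e = sum_smallest K (\<lambda>n. D $ n $ n * (c $ n)\<^sup>2))
      \<longleftrightarrow> (\<exists>D. (\<exists>d\<in>diagonal_minorants Q. D = Diag d) \<and>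
        e = sum_smallest K (\<lambda>n. D $ n $ n * (c $ n)\<^sup>2))"
      unfolding diagonal_minorants_iff[OF sym, symmetric] conj_assoc ..
    then show ?thesis
      by (auto simp: Diag_def)
  qed
  have "E_d Q c K = ?S d"
    unfolding E_d_def ex using d by (intro Greatest_equality) auto
  then show ?thesis
    using that[of d] d by simp
qed

section \<open>Numbers of zero components\<close>

text \<open>All the counts to be compared are maxima of this form, and in each case \<open>K = 0\<close> qualifies.\<close>

lemma Max_upto:
  fixes N :: nat
  assumes "P 0"
  shows "Max {K. K \<le> N \<and> P K} \<le> N" and "P (Max {K. K \<le> N \<and> P K})"
    and "K \<le> N \<Longrightarrow> P K \<Longrightarrow> K \<le> Max {K. K \<le> N \<and> P K}"
proof -
  have "Max {K. K \<le> N \<and> P K} \<in> {K. K \<le> N \<and> P K}"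
    using assms by (intro Max_in) auto
  then show "Max {K. K \<le> N \<and> P K} \<le> N" and "P (Max {K. K \<le> N \<and> P K})"
    by auto
qed (rule Max_ge; simp)

lemma cardinality_eq:
  fixes x :: "real ^ 'n"
  shows "cardinality x = CARD('n) - card {n. x $ n = 0}"
proof -
  have "{n. x $ n \<noteq> 0} = UNIV - {n. x $ n = 0}"
    by auto
  then show ?thesis
    unfolding cardinality_def by (simp add: card_Diff_subset)
qed

lemma finite_cardinality_image:
  fixes X :: "(real ^ 'n) set"
  shows "finite (cardinality ` X)"
  by (rule finite_subset[of _ "{..CARD('n)}"]) (auto simp: cardinality_eq)

lemma K_star_ge:
  fixes x :: "real ^ 'n"
  assumes "x \<in> feasible_set Q c \<gamma>"
  shows "card {n. x $ n = 0} \<le> K_star Q c \<gamma>"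
proof -
  have "optimal_cost Q c \<gamma> \<le> cardinality x"
    unfolding optimal_cost_def using assms by (intro Min_le finite_cardinality_image) auto
  moreover have "card {n. x $ n = 0} \<le> CARD('n)"
    by (simp add: card_mono)
  ultimately show ?thesis
    by (simp add: K_star_def cardinality_eq)
qed

lemma K_star_attained:
  fixes c :: "real ^ 'n"
  assumes "0 \<le> \<gamma>"
  obtains x where "x \<in> feasible_set Q c \<gamma>" and "card {n. x $ n = 0} = K_star Q c \<gamma>"
proof -
  have "c \<in> feasible_set Q c \<gamma>"
    using assms by (simp add: feasible_set_def)
  then have "optimal_cost Q c \<gamma> \<in> cardinality ` feasible_set Q c \<gamma>"
    unfolding optimal_cost_def by (intro Min_in finite_cardinality_image) auto
  then obtain x where x: "x \<in> feasible_set Q c \<gamma>" "optimal_cost Q c \<gamma> = cardinality x"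
    by auto
  moreover have "card {n. x $ n = 0} \<le> CARD('n)"
    by (simp add: card_mono)
  ultimately show ?thesis
    using that[of x] by (simp add: K_star_def cardinality_eq)
qed

text \<open>At the zeros of \<open>x\<close> the displacement \<open>x - c\<close> equals \<open>- c\<close>, so the terms \<open>d $ n * (c $ n)\<^sup>2\<close> at
  these positions are part of the relaxed constraint function evaluated at \<open>x\<close>.\<close>

lemma E_d_le_if_feasible:
  assumes "pos_def Q" and "x \<in> feasible_set Q c \<gamma>"
  shows "E_d Q c (card {n. x $ n = 0}) \<le> \<gamma>"
proof -
  let ?Z = "{n. x $ n = 0}"
  have "card ?Z \<le> card (UNIV :: 'a set)"
    by (simp add: card_mono)
  then obtain d where d: "d \<in> diagonal_minorants Q"
      "E_d Q c (card ?Z) = sum_smallest (card ?Z) (\<lambda>n. d $ n * (c $ n)\<^sup>2)"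
    using E_d_attained[OF assms(1)] by metis
  have nn: "0 \<le> d $ n" for n
  proof -
    have "0 \<le> (\<Sum>i\<in>UNIV. d $ i * (axis n 1 $ i)\<^sup>2)"
      using d(1) by (simp add: diagonal_minorants_def)
    then show ?thesis
      by (simp add: axis_def if_distrib[of "\<lambda>a. a\<^sup>2"] if_distrib[of "\<lambda>a. _ * a"] cong: if_cong)
  qed
  have "E_d Q c (card ?Z) \<le> (\<Sum>n\<in>?Z. d $ n * (c $ n)\<^sup>2)"
    unfolding d(2) by (rule sum_smallest_le_sum)
  also have "\<dots> = (\<Sum>n\<in>?Z. d $ n * ((x - c) $ n)\<^sup>2)"
    by (intro sum.cong) auto
  also have "\<dots> \<le> (\<Sum>n\<in>UNIV. d $ n * ((x - c) $ n)\<^sup>2)"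
    by (intro sum_mono2) (auto intro!: mult_nonneg_nonneg nn)
  also have "\<dots> \<le> (x - c) \<bullet> (Q *v (x - c))"
    using d(1) unfolding diagonal_minorants_def by blast
  also have "\<dots> \<le> \<gamma>"
    using assms(2) by (simp add: feasible_set_def)
  finally show ?thesis .
qed

text \<open>If \<open>U > L\<close>, then \<open>L + 1\<close> violates its own threshold: \<open>\<gamma> < \<beta> * S(L + 1)\<close>. Monotonicity of the
  averages gives \<open>U * S(L + 1) \<le> (L + 1) * S(U)\<close>, and \<open>\<alpha> * S(U) \<le> \<gamma>\<close>; dividing by
  \<open>S(L + 1) > 0\<close> leaves the claim. If \<open>U \<le> L\<close>, it is clear from \<open>\<beta> \<ge> \<alpha>\<close>.\<close>

lemma Max_upto_ratio:
  fixes a :: "'n::finite \<Rightarrow> real"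
  assumes "0 < \<gamma>" and "0 < \<alpha>" and "\<alpha> \<le> \<beta>"
    and L: "L = Max {K. K \<le> CARD('n) \<and> \<beta> * sum_smallest K a \<le> \<gamma>}"
    and U: "U = Max {K. K \<le> CARD('n) \<and> \<alpha> * sum_smallest K a \<le> \<gamma>}"
  shows "real U < (real L + 1) * (\<beta> / \<alpha>)"
proof (cases "U \<le> L")
  case True
  have "(real L + 1) * 1 \<le> (real L + 1) * (\<beta> / \<alpha>)"
    using assms(2,3) by (intro mult_left_mono) auto
  then show ?thesis
    using of_nat_mono[OF True, where 'a = real] by (simp only: mult_1_right)
next
  case False
  let ?S = "\<lambda>K. sum_smallest K a"
  have U': "U \<le> CARD('n)" "\<alpha> * ?S U \<le> \<gamma>"
    unfolding U using assms(1) Max_upto[of "\<lambda>K. \<alpha> * ?S K \<le> \<gamma>"] by auto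
  have "\<not> \<beta> * ?S (Suc L) \<le> \<gamma>"
    using Max_upto(3)[of "\<lambda>K. \<beta> * ?S K \<le> \<gamma>" "Suc L" "CARD('n)"] assms(1) False U'(1)
    unfolding L[symmetric] by auto
  then have S: "\<gamma> < \<beta> * ?S (Suc L)"
    by simp
  then have "0 < ?S (Suc L)"
    using assms(1-3) by (metis less_trans order_less_le_trans zero_less_mult_pos)
  moreover have "\<alpha> * real U * ?S (Suc L) < (real L + 1) * \<beta> * ?S (Suc L)"
  proof -
    have "real U * ?S (Suc L) \<le> real (Suc L) * ?S U"
      using False U'(1) by (intro sum_smallest_average_mono) auto
    then have "\<alpha> * (real U * ?S (Suc L)) \<le> \<alpha> * (real (Suc L) * ?S U)"
      using assms(2) by (intro mult_left_mono) auto
    also have "\<dots> \<le> real (Suc L) * \<gamma>"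
      using mult_left_mono[OF U'(2), of "real (Suc L)"] by (simp add: mult_ac)
    also have "\<dots> < real (Suc L) * (\<beta> * ?S (Suc L))"
      using S by (intro mult_strict_left_mono) auto
    finally show ?thesis
      by (simp add: mult_ac add.commute)
  qed
  ultimately have "\<alpha> * real U < (real L + 1) * \<beta>"
    by simp
  then show ?thesis
    using assms(2) by (simp add: field_simps)
qed

section \<open>The bounds on the numbers of zeros\<close>

lemma ratio_mono_num:
  assumes "a \<le> b" and "0 \<le> c"
  shows "ratio a c \<le> ratio b c"
  unfolding ratio_def divide_ereal_def using assms
  by (intro ereal_mult_right_mono) (auto intro: ereal_inverse_nonneg_iff[THEN iffD2])

text \<open>A vanishing smaller denominator makes the right side infinite, except for \<open>0 / 0\<close>, which is 0 in
  the extended reals; then the left side is 0 as well.\<close>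

lemma ratio_antimono_den:
  assumes "0 \<le> a" and "0 \<le> b" and "b \<le> c"
  shows "ratio a c \<le> ratio a b"
proof (cases "b = 0")
  case True
  then show ?thesis
    using assms by (cases "a = 0") (auto simp: ratio_def)
next
  case False
  then show ?thesis
    using assms by (auto simp: ratio_def divide_left_mono)
qed

theorem theorem4p7:
  fixes Q \<Delta> :: "real ^ 'n ^ 'n" and c lam :: "real ^ 'n" and \<gamma> :: real
  assumes "pos_def Q"
    and "\<gamma> > 0"
    and "\<And>n. (c $ n)\<^sup>2 / (matrix_inv Q $ n $ n) \<le> \<gamma>"
    and "orthogonal_matrix (mat 1 + \<Delta>)"
    and "Q = (mat 1 + \<Delta>) ** Diag lam ** transpose (mat 1 + \<Delta>)"
    and "cond_number Q * spectral_radius \<Delta> < 1"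
  shows "K_na_lower Q \<Delta> lam c \<gamma> \<le> K_star Q c \<gamma>
    \<and> K_star Q c \<gamma> \<le> K_d Q c \<gamma>
    \<and> K_d Q c \<gamma> \<le> K_na_upper Q \<Delta> lam c \<gamma>
    \<and> ratio (K_d Q c \<gamma>) (K_star Q c \<gamma>)
        \<le> ratio (K_na_upper Q \<Delta> lam c \<gamma>) (K_na_lower Q \<Delta> lam c \<gamma>)
    \<and> ratio (K_na_upper Q \<Delta> lam c \<gamma>) (K_na_lower Q \<Delta> lam c \<gamma>)
        \<le> ratio (\<lceil>(real (K_na_lower Q \<Delta> lam c \<gamma>) + 1) * r_na Q \<Delta>\<rceil> - 1)
              (K_na_lower Q \<Delta> lam c \<gamma>)"
proof -
  let ?\<kappa> = "cond_number Q" and ?\<rho> = "spectral_radius \<Delta>"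
  let ?S = "\<lambda>K. sum_smallest K (\<lambda>n. lam $ n * (c $ n)\<^sup>2)"
  define L U where "L = K_na_lower Q \<Delta> lam c \<gamma>" and "U = K_na_upper Q \<Delta> lam c \<gamma>"
  note pert = eigenvalue_perturbation[OF assms(1,4,5)]
  define \<alpha> \<beta> where "\<alpha> = 1 - ?\<kappa> * ?\<rho>" and "\<beta> = 1 + ?\<kappa> * (?\<rho> + ?\<rho>\<^sup>2)"
  have \<beta>: "1 + ?\<kappa> * ?\<rho> \<le> \<beta>"
    using pert(2,3) by (simp add: \<beta>_def ring_distribs)
  have \<alpha>: "0 < \<alpha>" "\<alpha> \<le> \<beta>"
    using assms(6) \<beta> mult_nonneg_nonneg[OF pert(3,2)] unfolding \<alpha>_def by linarith+
  have Ldef: "L = Max {K. K \<le> CARD('n) \<and> \<beta> * ?S K \<le> \<gamma>}"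
    and Udef: "U = Max {K. K \<le> CARD('n) \<and> \<alpha> * ?S K \<le> \<gamma>}"
    by (simp_all add: L_def U_def K_na_lower_def K_na_upper_def \<alpha>_def \<beta>_def)
  have LK: "L \<le> K_star Q c \<gamma>"
  proof -
    have L: "L \<le> CARD('n)" "\<beta> * ?S L \<le> \<gamma>"
      unfolding Ldef using assms(2) Max_upto[of "\<lambda>K. \<beta> * ?S K \<le> \<gamma>"] by auto
    obtain Z where Z: "card Z = L" "?S L = (\<Sum>n\<in>Z. lam $ n * (c $ n)\<^sup>2)"
      using sum_smallest_attained[OF L(1)] .
    define x where "x = (\<chi> n. if n \<in> Z then 0 else c $ n)"
    have "(\<Sum>n\<in>UNIV. lam $ n * ((x - c) $ n)\<^sup>2) = ?S L"
      unfolding Z(2) by (rule sum.mono_neutral_cong_right) (auto simp: x_def)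
    moreover have "0 \<le> ?S L"
      unfolding Z(2) by (intro sum_nonneg mult_nonneg_nonneg) (auto intro: less_imp_le pert(4))
    ultimately have "(x - c) \<bullet> (Q *v (x - c)) \<le> \<beta> * ?S L"
      using pert(1)[of "x - c"] mult_right_mono[OF \<beta>, of "?S L"]
      by (simp add: ring_distribs)
    then have "x \<in> feasible_set Q c \<gamma>"
      using L(2) by (simp add: feasible_set_def)
    then have "card {n. x $ n = 0} \<le> K_star Q c \<gamma>"
      by (rule K_star_ge)
    moreover have "card Z \<le> card {n. x $ n = 0}"
      by (rule card_mono) (auto simp: x_def)
    ultimately show ?thesis
      using Z(1) by simp
  qed
  have E0: "E_d Q c 0 \<le> \<gamma>"
    using E_d_attained[OF assms(1), of 0 c] assms(2) by (metis less_imp_le sum_smallest_0 zero_le)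
  have KD: "K_star Q c \<gamma> \<le> K_d Q c \<gamma>"
  proof -
    obtain x where x: "x \<in> feasible_set Q c \<gamma>" "card {n. x $ n = 0} = K_star Q c \<gamma>"
      using K_star_attained assms(2) less_imp_le by metis
    then have "E_d Q c (K_star Q c \<gamma>) \<le> \<gamma>"
      using E_d_le_if_feasible[OF assms(1)] by metis
    moreover have "K_star Q c \<gamma> \<le> CARD('n)"
      by (simp add: K_star_def)
    ultimately show ?thesis
      unfolding K_d_def using E0 by (intro Max_upto(3))
  qed
  have DU: "K_d Q c \<gamma> \<le> U"
  proof -
    have K: "K_d Q c \<gamma> \<le> CARD('n)" "E_d Q c (K_d Q c \<gamma>) \<le> \<gamma>"
      using Max_upto[of "\<lambda>K. E_d Q c K \<le> \<gamma>"] E0 by (auto simp: K_d_def)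
    have "\<alpha> *\<^sub>R lam \<in> diagonal_minorants Q"
    proof -
      have "0 \<le> (\<Sum>n\<in>UNIV. lam $ n * (x $ n)\<^sup>2)" for x :: "real ^ 'n"
        by (intro sum_nonneg mult_nonneg_nonneg) (auto intro: less_imp_le pert(4))
      moreover have "\<alpha> * (\<Sum>n\<in>UNIV. lam $ n * (x $ n)\<^sup>2) \<le> x \<bullet> (Q *v x)" for x
        using pert(1)[of x] by (simp add: \<alpha>_def ring_distribs)
      ultimately show ?thesis
        using \<alpha>(1) by (simp add: diagonal_minorants_def sum_distrib_left[symmetric] mult.assoc)
    qed
    then have "sum_smallest (K_d Q c \<gamma>) (\<lambda>n. (\<alpha> *\<^sub>R lam) $ n * (c $ n)\<^sup>2)
        \<le> E_d Q c (K_d Q c \<gamma>)"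
      by - (rule E_d_attained[OF assms(1) K(1), of c], blast)
    then have "sum_smallest (K_d Q c \<gamma>) (\<lambda>n. \<alpha> * (lam $ n * (c $ n)\<^sup>2)) \<le> E_d Q c (K_d Q c \<gamma>)"
      by (simp add: mult.assoc)
    then have "\<alpha> * ?S (K_d Q c \<gamma>) \<le> \<gamma>"
      using K \<alpha>(1) by (simp add: sum_smallest_scale)
    then show ?thesis
      unfolding Udef using K(1) assms(2) by (intro Max_upto(3)) auto
  qed
  have "real U < (real L + 1) * r_na Q \<Delta>"
    using Max_upto_ratio[OF assms(2) \<alpha> Ldef Udef] by (simp add: r_na_def \<alpha>_def \<beta>_def)
  \<comment> \<open>The strict inequality between the integer \<open>U\<close> and a real is what allows the ceiling minus 1.\<close>
  then have "int U \<le> \<lceil>(real L + 1) * r_na Q \<Delta>\<rceil> - 1"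
    by (simp add: less_ceiling_iff)
  then have "real U \<le> real_of_int (\<lceil>(real L + 1) * r_na Q \<Delta>\<rceil> - 1)"
    by (metis of_int_le_iff of_int_of_nat_eq)
  then have "ratio U L \<le> ratio (\<lceil>(real L + 1) * r_na Q \<Delta>\<rceil> - 1) L"
    by (intro ratio_mono_num) auto
  moreover have "ratio (K_d Q c \<gamma>) (K_star Q c \<gamma>) \<le> ratio U L"
    using DU LK by (intro order_trans[OF ratio_mono_num ratio_antimono_den]) auto
  ultimately show ?thesis
    using LK KD DU unfolding L_def U_def by blast
qed

end
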